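(* Let $m\ge 2$, let $\mathcal{P}$ be an order-$m$, $n$-dimensional stochastic tensor, let $v$ and $x_0$ be stochastic vectors in $\mathbb{R}^n$, and let $0\le\alpha<1/(m-1)$. Then the fixed-point iteration $$x_{k+1}=\alpha\,\mathcal{P}x_k^{m-1}+(1-\alpha)v$$ converges to the unique solution $x$ of the multilinear PageRank problem $(\alpha,\mathcal{P},v)$, and for all $k\ge 0$ $$\|x_k-x\|_1\le[\alpha(m-1)]^k\,\|x_0-x\|_1\le 2[\alpha(m-1)]^k .$$
   Context: A vector is stochastic if its entries are nonnegative and sum to $1$. An order-$m$, $n$-dimensional tensor is an array with $m$ indices, each ranging over $1,\dots,n$; it is stochastic if its entries are nonnegative and, for every fixed choice of the last $m-1$ indices, the sum over the first index equals $1$. For $x\in\mathbb{R}^n$, $[\mathcal{P}x^{m-1}]_i=\sum_{i_2,\dots,i_m}\mathcal{P}(i,i_2,\dots,i_m)\,x_{i_2}\cdots x_{i_m}$. A solution of the multilinear PageRank problem $(\alpha,\mathcal{P},v)$ is a stochastic vector $x$ with $x=\alpha\,\mathcal{P}x^{m-1}+(1-\alpha)v$; for $\alpha<1/(m-1)$ it exists and is unique. *)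

theory Defs
  imports "HOL-Analysis.Analysis"
begin

definition stochastic_vec :: "real ^ 'n::finite \<Rightarrow> bool" where
  "stochastic_vec x \<longleftrightarrow> (\<forall>i. 0 \<le> x $ i) \<and> (\<Sum>i\<in>UNIV. x $ i) = 1"

text \<open>
  An order-\<open>m\<close>, \<open>n\<close>-dimensional tensor is a function on multi-indices, i.e. on lists of
  length \<open>m\<close> over an index type with \<open>n\<close> elements; its values on lists of any other length
  are irrelevant. The entry \<open>P(i, i\<^sub>2, \<dots>, i\<^sub>m)\<close> is \<open>P (i # [i\<^sub>2, \<dots>, i\<^sub>m])\<close>.
\<close>

type_synonym 'n tensor = "'n list \<Rightarrow> real"

definition stochastic_tensor :: "nat \<Rightarrow> 'n::finite tensor \<Rightarrow> bool" where
  "stochastic_tensor m P \<longleftrightarrow>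
     (\<forall>is. length is = m \<longrightarrow> 0 \<le> P is) \<and>
     (\<forall>js. length js = m - 1 \<longrightarrow> (\<Sum>i\<in>UNIV. P (i # js)) = 1)"

definition tensor_apply :: "nat \<Rightarrow> 'n::finite tensor \<Rightarrow> real ^ 'n \<Rightarrow> real ^ 'n" where
  "tensor_apply m P x =
     (\<chi> i. \<Sum>js | length js = m - 1. P (i # js) * (\<Prod>l<m - 1. x $ (js ! l)))"

definition pagerank_map ::
    "nat \<Rightarrow> real \<Rightarrow> 'n::finite tensor \<Rightarrow> real ^ 'n \<Rightarrow> real ^ 'n \<Rightarrow> real ^ 'n" where
  "pagerank_map m \<alpha> P v x = \<alpha> *\<^sub>R tensor_apply m P x + (1 - \<alpha>) *\<^sub>R v"

definition pagerank_solution ::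
    "nat \<Rightarrow> real \<Rightarrow> 'n::finite tensor \<Rightarrow> real ^ 'n \<Rightarrow> real ^ 'n \<Rightarrow> bool" where
  "pagerank_solution m \<alpha> P v x \<longleftrightarrow> stochastic_vec x \<and> x = pagerank_map m \<alpha> P v x"

primrec pagerank_iter ::
    "nat \<Rightarrow> real \<Rightarrow> 'n::finite tensor \<Rightarrow> real ^ 'n \<Rightarrow> real ^ 'n \<Rightarrow> nat \<Rightarrow> real ^ 'n" where
  "pagerank_iter m \<alpha> P v x0 0 = x0"
| "pagerank_iter m \<alpha> P v x0 (Suc k) = pagerank_map m \<alpha> P v (pagerank_iter m \<alpha> P v x0 k)"

definition norm1 :: "real ^ 'n::finite \<Rightarrow> real" where
  "norm1 x = (\<Sum>i\<in>UNIV. \<bar>x $ i\<bar>)"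

end

theory Submission
  imports Defs
begin

text \<open>
  Reading a stochastic vector \<open>x\<close> as a probability distribution, the product
  \<open>x\<^bsub>i\<^sub>2\<^esub> \<cdots> x\<^bsub>i\<^sub>m\<^esub>\<close> is the probability of drawing the tuple \<open>(i\<^sub>2, \<dots>, i\<^sub>m)\<close> in
  \<open>m - 1\<close> independent draws, and the tensor is a transition matrix from tuples to single indices.
  Two facts then make the iteration a contraction of the probability simplex in the 1-norm:
  the 1-distance of the \<open>N\<close>-fold product distributions of \<open>x\<close> and \<open>y\<close> is at most \<open>N\<close> times that
  of \<open>x\<close> and \<open>y\<close>, because the factors can be exchanged one at a time
  (\<open>l1_dist_product_distribution\<close>), and applying a transition matrix never increases the
  1-distance (\<open>tensor_apply_lipschitz\<close>). The contraction factor is \<open>\<alpha> (m - 1) < 1\<close>.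

  Since the simplex is compact, the distance between a point and its image attains a minimum
  there, and contractivity forces this minimum to be zero
  (\<open>pagerank_solution_exists\<close>). Contracting towards this solution gives the error bound,
  and with it uniqueness and convergence.
\<close>

section \<open>Products of distributions\<close>

lemma sum_lists_length_Suc:
  fixes f :: "'n::finite list \<Rightarrow> 'a::comm_monoid_add"
  shows "(\<Sum>js | length js = Suc N. f js) = (\<Sum>i\<in>UNIV. \<Sum>js | length js = N. f (i # js))"
proof -
  have "{js::'n list. length js = Suc N} = (\<lambda>(i, js). i # js) ` (UNIV \<times> {js. length js = N})"
    by (auto simp: length_Suc_conv image_iff)
  moreover have "inj_on (\<lambda>(i, js). i # js) (UNIV \<times> {js::'n list. length js = N})"
    by (auto simp: inj_on_def)
  ultimately show ?thesis
    by (simp only: sum.reindex sum.cartesian_product) (simp add: case_prod_beta)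
qed

lemma sum_lists_prod_list:
  fixes f :: "'n::finite \<Rightarrow> 'a::comm_semiring_1"
  shows "(\<Sum>js | length js = N. prod_list (map f js)) = (\<Sum>i\<in>UNIV. f i) ^ N"
  by (induction N)
    (simp_all add: sum_lists_length_Suc sum_distrib_left[symmetric] sum_distrib_right[symmetric])

text \<open>
  Exchanging the first factor costs \<open>\<bar>f i - g i\<bar>\<close> weighted by the remaining factors of \<open>f\<close>, and
  exchanging the remaining ones costs their distance weighted by \<open>g i\<close>; both families of weights
  sum to 1, so each of the \<open>N\<close> exchanges contributes at most the distance of \<open>f\<close> and \<open>g\<close>.
\<close>

lemma l1_dist_product_distribution:
  fixes f g :: "'n::finite \<Rightarrow> real"
  assumes f: "\<And>i. 0 \<le> f i" "(\<Sum>i\<in>UNIV. f i) = 1"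
    and g: "\<And>i. 0 \<le> g i" "(\<Sum>i\<in>UNIV. g i) = 1"
  shows "(\<Sum>js | length js = N. \<bar>prod_list (map f js) - prod_list (map g js)\<bar>)
           \<le> real N * (\<Sum>i\<in>UNIV. \<bar>f i - g i\<bar>)"
proof (induction N)
  case 0
  show ?case by simp
next
  case (Suc N)
  define F G where "F = (\<lambda>js. prod_list (map f js))" and "G = (\<lambda>js. prod_list (map g js))"
  define d where "d = (\<Sum>i\<in>UNIV. \<bar>f i - g i\<bar>)"
  have F_nonneg: "0 \<le> F js" for js
    unfolding F_def by (induction js) (simp_all add: f)
  have exchange: "\<bar>f i * F js - g i * G js\<bar> \<le> \<bar>f i - g i\<bar> * F js + g i * \<bar>F js - G js\<bar>" for i js
  proof -
    have "f i * F js - g i * G js = (f i - g i) * F js + g i * (F js - G js)"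
      by (simp add: algebra_simps)
    then show ?thesis
      using abs_triangle_ineq[of "(f i - g i) * F js" "g i * (F js - G js)"]
      by (simp add: abs_mult F_nonneg g)
  qed
  have "(\<Sum>js | length js = Suc N. \<bar>F js - G js\<bar>)
      = (\<Sum>i\<in>UNIV. \<Sum>js | length js = N. \<bar>f i * F js - g i * G js\<bar>)"
    by (simp add: sum_lists_length_Suc F_def G_def)
  also have "\<dots> \<le> (\<Sum>i\<in>UNIV. \<Sum>js | length js = N.
                    \<bar>f i - g i\<bar> * F js + g i * \<bar>F js - G js\<bar>)"
    by (intro sum_mono exchange)
  also have "\<dots> = d * (\<Sum>js | length js = N. F js)
      + (\<Sum>i\<in>UNIV. g i) * (\<Sum>js | length js = N. \<bar>F js - G js\<bar>)"
    by (simp add: d_def sum.distrib sum_product)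
  also have "\<dots> = d + (\<Sum>js | length js = N. \<bar>F js - G js\<bar>)"
    by (simp add: F_def sum_lists_prod_list f g)
  also have "\<dots> \<le> real (Suc N) * d"
    using Suc.IH by (simp add: F_def G_def d_def algebra_simps)
  finally show ?case
    by (simp add: F_def G_def d_def)
qed

section \<open>Contraction of the simplex\<close>

lemma norm1_eq_0_iff: "norm1 x = 0 \<longleftrightarrow> x = 0"
  by (simp add: norm1_def sum_nonneg_eq_0_iff vec_eq_iff)

lemma norm1_nonneg: "0 \<le> norm1 x"
  by (simp add: norm1_def sum_nonneg)

lemma norm1_scaleR: "norm1 (c *\<^sub>R x) = \<bar>c\<bar> * norm1 x"
  by (simp add: norm1_def abs_mult sum_distrib_left)

lemma norm1_diff_stochastic_le_2:
  assumes "stochastic_vec x" "stochastic_vec y"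
  shows "norm1 (x - y) \<le> 2"
proof -
  have "norm1 (x - y) \<le> (\<Sum>i\<in>UNIV. x $ i + y $ i)"
    unfolding norm1_def using assms
    by (intro sum_mono) (auto simp: stochastic_vec_def abs_le_iff add_increasing add_increasing2)
  also have "\<dots> = 2"
    using assms by (simp add: stochastic_vec_def sum.distrib)
  finally show ?thesis .
qed

lemma compact_stochastic_vecs: "compact {x::real^'n::finite. stochastic_vec x}"
proof -
  have "closed {x::real^'n. stochastic_vec x}"
    unfolding stochastic_vec_def
    by (intro closed_Collect_conj closed_Collect_all closed_Collect_le closed_Collect_eq
        continuous_intros)
  moreover have "norm x \<le> 1" if "stochastic_vec x" for x :: "real^'n"
    using norm_le_l1_cart[of x] that by (simp add: stochastic_vec_def)
  then have "bounded {x::real^'n. stochastic_vec x}"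
    by (auto simp: bounded_iff)
  ultimately show ?thesis
    by (simp add: compact_eq_bounded_closed)
qed

lemma tensor_apply_prod_list:
  "tensor_apply m P x $ i = (\<Sum>js | length js = m - 1. P (i # js) * prod_list (map (($) x) js))"
  unfolding tensor_apply_def vec_lambda_beta
  by (rule sum.cong[OF refl]) (simp add: prod.list_conv_set_nth atLeast0LessThan)

lemma sum_stochastic_tensor:
  assumes "stochastic_tensor m P"
  shows "(\<Sum>i\<in>UNIV. \<Sum>js | length js = m - 1. P (i # js) * h js)
           = (\<Sum>js | length js = m - 1. h js)"
proof -
  have "(\<Sum>i\<in>UNIV. \<Sum>js | length js = m - 1. P (i # js) * h js)
      = (\<Sum>js | length js = m - 1. \<Sum>i\<in>UNIV. P (i # js) * h js)"
    by (rule sum.swap)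
  also have "\<dots> = (\<Sum>js | length js = m - 1. h js)"
    using assms
    by (intro sum.cong refl) (simp add: stochastic_tensor_def sum_distrib_right[symmetric])
  finally show ?thesis .
qed

lemma stochastic_vec_tensor_apply:
  assumes "m \<ge> 1" "stochastic_tensor m P" "stochastic_vec x"
  shows "stochastic_vec (tensor_apply m P x)"
proof -
  have "0 \<le> prod_list (map (($) x) js)" for js
    using assms(3) by (induction js) (simp_all add: stochastic_vec_def)
  then have "0 \<le> tensor_apply m P x $ i" for i
    unfolding tensor_apply_prod_list using assms
    by (intro sum_nonneg mult_nonneg_nonneg) (auto simp: stochastic_tensor_def)
  moreover have "(\<Sum>i\<in>UNIV. tensor_apply m P x $ i) = 1"
    using assms(3) unfolding tensor_apply_prod_list sum_stochastic_tensor[OF assms(2)]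
    by (simp add: sum_lists_prod_list stochastic_vec_def)
  ultimately show ?thesis
    by (simp add: stochastic_vec_def)
qed

text \<open>
  Each column of the tensor has total mass 1, so the distance between the images is at most
  the distance between the product distributions on multi-indices.
\<close>

lemma tensor_apply_lipschitz:
  assumes "m \<ge> 1" "stochastic_tensor m P" "stochastic_vec x" "stochastic_vec y"
  shows "norm1 (tensor_apply m P x - tensor_apply m P y) \<le> (real m - 1) * norm1 (x - y)"
proof -
  let ?D = "\<lambda>js. prod_list (map (($) x) js) - prod_list (map (($) y) js)"
  have "norm1 (tensor_apply m P x - tensor_apply m P y)
      = (\<Sum>i\<in>UNIV. \<bar>\<Sum>js | length js = m - 1. P (i # js) * ?D js\<bar>)"
    by (simp add: norm1_def tensor_apply_prod_list sum_subtractf right_diff_distrib)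
  also have "\<dots> \<le> (\<Sum>i\<in>UNIV. \<Sum>js | length js = m - 1. \<bar>P (i # js) * ?D js\<bar>)"
    by (intro sum_mono sum_abs)
  also have "\<dots> = (\<Sum>i\<in>UNIV. \<Sum>js | length js = m - 1. P (i # js) * \<bar>?D js\<bar>)"
    using assms(1,2) by (intro sum.cong refl) (auto simp: abs_mult stochastic_tensor_def)
  also have "\<dots> = (\<Sum>js | length js = m - 1. \<bar>?D js\<bar>)"
    by (rule sum_stochastic_tensor[OF assms(2)])
  also have "\<dots> \<le> real (m - 1) * (\<Sum>i\<in>UNIV. \<bar>x $ i - y $ i\<bar>)"
    using assms(3,4) by (intro l1_dist_product_distribution) (auto simp: stochastic_vec_def)
  finally show ?thesis
    using assms(1) by (simp add: norm1_def of_nat_diff)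
qed

lemma stochastic_vec_pagerank_map:
  assumes "m \<ge> 1" "stochastic_tensor m P" "stochastic_vec v" "stochastic_vec x"
    and "0 \<le> \<alpha>" "\<alpha> \<le> 1"
  shows "stochastic_vec (pagerank_map m \<alpha> P v x)"
  using stochastic_vec_tensor_apply[OF assms(1,2,4)] assms(3,5,6)
  by (auto simp: stochastic_vec_def pagerank_map_def sum.distrib sum_distrib_left[symmetric])

lemma pagerank_map_lipschitz:
  assumes "m \<ge> 1" "stochastic_tensor m P" "stochastic_vec x" "stochastic_vec y" "0 \<le> \<alpha>"
  shows "norm1 (pagerank_map m \<alpha> P v x - pagerank_map m \<alpha> P v y)
           \<le> \<alpha> * (real m - 1) * norm1 (x - y)"
proof -
  have "pagerank_map m \<alpha> P v x - pagerank_map m \<alpha> P v y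
      = \<alpha> *\<^sub>R (tensor_apply m P x - tensor_apply m P y)"
    by (simp add: pagerank_map_def scaleR_diff_right)
  then show ?thesis
    using mult_left_mono[OF tensor_apply_lipschitz[OF assms(1-4)] assms(5)] assms(5)
    by (simp add: norm1_scaleR mult.assoc)
qed

lemma continuous_on_pagerank_map: "continuous_on S (pagerank_map m \<alpha> P v)"
  unfolding pagerank_map_def tensor_apply_def by (intro continuous_intros)

section \<open>The fixed point and the iteration towards it\<close>

text \<open>
  A point of the compact simplex that minimises its distance to its image is fixed: otherwise
  its image would lie strictly closer to its own image. The argument is carried out in the
  1-norm because a contraction in the 1-norm need not be one
  in the Euclidean metric that \<^typ>\<open>real ^ 'n\<close> carries.
\<close>

lemma pagerank_solution_exists:
  fixes v :: "real ^ 'n::finite"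
  assumes "m \<ge> 1" "stochastic_tensor m P" "stochastic_vec v"
    and "0 \<le> \<alpha>" "\<alpha> \<le> 1" "\<alpha> * (real m - 1) < 1"
  shows "\<exists>x. pagerank_solution m \<alpha> P v x"
proof -
  let ?S = "{x::real^'n. stochastic_vec x}" and ?f = "pagerank_map m \<alpha> P v"
  have "continuous_on ?S (\<lambda>x. norm1 (x - ?f x))"
    unfolding norm1_def by (intro continuous_intros continuous_on_pagerank_map)
  moreover have "?S \<noteq> {}"
    using assms(3) by auto
  ultimately obtain x where x: "stochastic_vec x"
    and min: "\<And>y. stochastic_vec y \<Longrightarrow> norm1 (x - ?f x) \<le> norm1 (y - ?f y)"
    using continuous_attains_inf[OF compact_stochastic_vecs] by blast
  have fx: "stochastic_vec (?f x)"
    by (intro stochastic_vec_pagerank_map assms x)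
  have "norm1 (x - ?f x) \<le> norm1 (?f x - ?f (?f x))"
    by (rule min[OF fx])
  also have "\<dots> \<le> \<alpha> * (real m - 1) * norm1 (x - ?f x)"
    by (intro pagerank_map_lipschitz assms x fx)
  finally have "norm1 (x - ?f x) = 0"
    using assms(6) norm1_nonneg[of "x - ?f x"]
    by (smt (verit) mult_less_cancel_right2)
  then show ?thesis
    using x by (auto simp: pagerank_solution_def norm1_eq_0_iff)
qed

lemma stochastic_vec_pagerank_iter:
  assumes "m \<ge> 1" "stochastic_tensor m P" "stochastic_vec v" "stochastic_vec x0"
    and "0 \<le> \<alpha>" "\<alpha> \<le> 1"
  shows "stochastic_vec (pagerank_iter m \<alpha> P v x0 k)"
  by (induction k) (use assms stochastic_vec_pagerank_map[OF assms(1-3) _ assms(5,6)] in simp_all)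

lemma pagerank_iter_error:
  assumes "m \<ge> 1" "stochastic_tensor m P" "stochastic_vec v" "stochastic_vec x0"
    and "0 \<le> \<alpha>" "\<alpha> \<le> 1" and sol: "pagerank_solution m \<alpha> P v x"
  shows "norm1 (pagerank_iter m \<alpha> P v x0 k - x) \<le> (\<alpha> * (real m - 1)) ^ k * norm1 (x0 - x)"
proof (induction k)
  case 0
  show ?case by simp
next
  case (Suc k)
  let ?c = "\<alpha> * (real m - 1)" and ?z = "pagerank_iter m \<alpha> P v x0 k"
  have x: "stochastic_vec x" and fix_x: "pagerank_map m \<alpha> P v x = x"
    using sol by (auto simp: pagerank_solution_def)
  have "norm1 (pagerank_map m \<alpha> P v ?z - pagerank_map m \<alpha> P v x) \<le> ?c * norm1 (?z - x)"
    by (intro pagerank_map_lipschitz stochastic_vec_pagerank_iter assms x)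
  also have "\<dots> \<le> ?c * (?c ^ k * norm1 (x0 - x))"
    using assms by (intro mult_left_mono Suc.IH) simp
  finally show ?case
    by (simp add: fix_x mult.assoc)
qed

theorem theorem5p1:
  fixes m :: nat and \<alpha> :: real
    and P :: "'n::finite tensor"
    and v x0 :: "real ^ 'n"
  assumes "m \<ge> 2"
    and "stochastic_tensor m P"
    and "stochastic_vec v"
    and "stochastic_vec x0"
    and "0 \<le> \<alpha>" and "\<alpha> < 1 / (real m - 1)"
  shows "\<exists>x. pagerank_solution m \<alpha> P v x
           \<and> (\<forall>y. pagerank_solution m \<alpha> P v y \<longrightarrow> y = x)
           \<and> (\<lambda>k. pagerank_iter m \<alpha> P v x0 k) \<longlonglongrightarrow> x
           \<and> (\<forall>k. norm1 (pagerank_iter m \<alpha> P v x0 k - x)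
                      \<le> (\<alpha> * (real m - 1)) ^ k * norm1 (x0 - x)
                \<and> (\<alpha> * (real m - 1)) ^ k * norm1 (x0 - x)
                      \<le> 2 * (\<alpha> * (real m - 1)) ^ k)"
proof -
  let ?c = "\<alpha> * (real m - 1)" and ?z = "pagerank_iter m \<alpha> P v x0"
  have m: "m \<ge> 1" "real m - 1 \<ge> 1"
    using assms(1) by auto
  have "0 \<le> ?c"
    using m assms(5) by simp
  moreover have "?c < 1"
    using m assms(6) by (simp add: less_divide_eq)
  ultimately have c: "0 \<le> ?c" "?c < 1" .
  have "1 / (real m - 1) \<le> 1"
    using m by simp
  then have \<alpha>: "\<alpha> \<le> 1"
    using assms(6) by linarith
  obtain x where x: "pagerank_solution m \<alpha> P v x"
    using pagerank_solution_exists[OF m(1) assms(2,3,5) \<alpha> c(2)] by blast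
  have err: "norm1 (?z k - x) \<le> ?c ^ k * norm1 (x0 - x)" for k
    by (intro pagerank_iter_error m assms \<alpha> x)
  have unique: "y = x" if y: "pagerank_solution m \<alpha> P v y" for y
  proof -
    have "norm1 (y - x) \<le> ?c * norm1 (y - x)"
      using x y pagerank_map_lipschitz[OF m(1) assms(2) _ _ assms(5), of y x v]
      by (auto simp: pagerank_solution_def)
    then have "norm1 (y - x) = 0"
      using c(2) norm1_nonneg[of "y - x"] by (smt (verit) mult_less_cancel_right2)
    then show ?thesis
      by (simp add: norm1_eq_0_iff)
  qed
  have "(\<lambda>k. ?c ^ k * norm1 (x0 - x)) \<longlonglongrightarrow> 0"
    using LIMSEQ_realpow_zero[OF c] by (intro tendsto_mult_left_zero)
  moreover have "norm (?z k - x) \<le> ?c ^ k * norm1 (x0 - x)" for k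
    using norm_le_l1_cart[of "?z k - x"] err[of k] by (simp add: norm1_def)
  ultimately have "(\<lambda>k. ?z k - x) \<longlonglongrightarrow> 0"
    by (rule Lim_null_comparison[OF eventuallyI, rotated])
  then have lim: "?z \<longlonglongrightarrow> x"
    by (rule LIM_zero_cancel)
  have "norm1 (x0 - x) \<le> 2"
    using x assms(4) by (intro norm1_diff_stochastic_le_2) (auto simp: pagerank_solution_def)
  then have "?c ^ k * norm1 (x0 - x) \<le> 2 * ?c ^ k" for k
    using mult_left_mono[of "norm1 (x0 - x)" 2 "?c ^ k"] c(1) by (simp add: mult.commute)
  then show ?thesis
    using x unique lim err by blast
qed

end
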